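(* For any integer $d \ge 15$, there exist infinitely many polynomials $f \in \mathbb{Z}[x]$ of degree $d$ such that every polynomial $g \in \mathbb{Z}[x]$ satisfying $L(f-g) \le 1$ is not square-free.
   Context: For $h(x) = a_n x^n + \cdots + a_0 \in \mathbb{Z}[x]$, its length is $L(h) = |a_n| + |a_{n-1}| + \cdots + |a_0|$ (with $L(0)=0$). A polynomial $g \in \mathbb{Z}[x]$ is called square-free if there is no polynomial $h \in \mathbb{Z}[x]$ of degree at least $1$ such that $h^2$ divides $g$. *)

theory Defs
  imports "HOL-Computational_Algebra.Computational_Algebra"
begin

definition poly_length :: "int poly \<Rightarrow> int" where
  "poly_length h = (\<Sum>i\<le>degree h. \<bar>coeff h i\<bar>)"

(* Unlike the library's squarefree, only square divisors of positive degree are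
   excluded: 4 * x is square-free in this sense. The zero polynomial is not. *)
definition square_free_poly :: "int poly \<Rightarrow> bool" where
  "square_free_poly g \<longleftrightarrow> \<not> (\<exists>h :: int poly. degree h \<ge> 1 \<and> h ^ 2 dvd g)"

end

theory Submission
  imports Defs
begin

text \<open>
  A polynomial \<open>f\<close> divisible by \<open>x\<^sup>2\<close> absorbs all perturbations \<open>\<plusminus>x\<^sup>k\<close> with \<open>k \<noteq> 0, 1\<close>, so only
  \<open>f \<plusminus> 1\<close> and \<open>f \<plusminus> x\<close> remain.  Square factors of these four are forced by congruences
  modulo the squares of \<open>1 + 2x\<close>, \<open>1 - 6x\<close>, \<open>1 + 6x\<close> and \<open>1 + 3x\<close>.  These linear polynomials and
  \<open>x\<close> pairwise generate the unit ideal of \<open>\<int>[x]\<close>, because every prime dividing a difference of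
  two of \<open>2, -6, 6, 3\<close> divides both numbers; hence the congruences are solvable.  Any multiple
  of the product of the five squares, which has degree 10, may be added to a solution.
\<close>

text \<open>The leading coefficient of a nonzero integer polynomial already contributes at least 1
  to the length, so nothing is left for the lower ones.\<close>

lemma poly_length_le_1_imp_monom:
  assumes "poly_length p \<le> 1"
  obtains c k where "p = monom c k" "\<bar>c\<bar> \<le> 1"
proof (cases "p = 0")
  case True
  then show ?thesis using that[of 0 0] by simp
next
  case False
  define n where "n = degree p"
  have split: "poly_length p = (\<Sum>i<n. \<bar>coeff p i\<bar>) + \<bar>coeff p n\<bar>"
    unfolding poly_length_def n_def by (simp add: lessThan_Suc_atMost [symmetric])
  have pos: "\<bar>coeff p n\<bar> \<ge> 1"
    using False by (simp add: n_def int_one_le_iff_zero_less)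
  have nonneg: "(\<Sum>i<n. \<bar>coeff p i\<bar>) \<ge> 0"
    by (simp add: sum_nonneg)
  have "(\<Sum>i<n. \<bar>coeff p i\<bar>) = 0"
    using split pos nonneg assms by linarith
  then have zero: "coeff p i = 0" if "i < n" for i
    using that by (simp add: sum_nonneg_eq_0_iff)
  have "p = monom (coeff p n) n"
    by (rule poly_eqI) (metis zero coeff_eq_0 coeff_monom n_def nat_neq_iff)
  moreover have "\<bar>coeff p n\<bar> \<le> 1"
    using split nonneg assms by linarith
  ultimately show ?thesis by (rule that)
qed

lemma not_square_free_polyI:
  assumes "h ^ 2 dvd g" "degree h \<ge> 1"
  shows "\<not> square_free_poly g"
  using assms unfolding square_free_poly_def by blast

lemma not_square_free_near:
  fixes f :: "int poly"
  assumes f0: "[:0, 1:] ^ 2 dvd f"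
    and deg: "degree h1 \<ge> 1" "degree h2 \<ge> 1" "degree h3 \<ge> 1" "degree h4 \<ge> 1"
    and f1: "h1 ^ 2 dvd f - 1"
    and f2: "h2 ^ 2 dvd f + 1"
    and f3: "h3 ^ 2 dvd f - [:0, 1:]"
    and f4: "h4 ^ 2 dvd f + [:0, 1:]"
    and g: "poly_length (f - g) \<le> 1"
  shows "\<not> square_free_poly g"
proof -
  obtain c k where ck: "f - g = monom c k" "\<bar>c\<bar> \<le> 1"
    using g by (rule poly_length_le_1_imp_monom)
  have g_eq: "g = f - monom c k"
    using ck(1) by (simp add: algebra_simps)
  have c: "c = 0 \<or> c = 1 \<or> c = -1"
    using ck(2) by linarith
  show ?thesis
  \<comment> \<open>Here \<open>g\<close> keeps the factor \<open>[:0, 1:] ^ 2\<close> of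
    \<open>f\<close>; this includes \<open>g = f\<close>.\<close>
  proof (cases "c = 0 \<or> k \<ge> 2")
    case True
    have "[:0, 1:] ^ 2 dvd monom c k"
    proof (cases "c = 0")
      case False
      with True show ?thesis
        by (auto simp: monom_altdef intro!: dvd_smult le_imp_power_dvd)
    qed simp
    then have "[:0, 1:] ^ 2 dvd g"
      unfolding g_eq using f0 by (rule dvd_diff[rotated])
    then show ?thesis by (rule not_square_free_polyI) simp
  next
    case False
    then have "k = 0 \<or> k = 1" and "c = 1 \<or> c = -1"
      using c by auto
    then have "g \<in> {f - 1, f + 1, f - [:0, 1:], f + [:0, 1:]}"
      unfolding g_eq by (auto simp: monom_0 monom_Suc one_pCons)
    then show ?thesis
      using f1 f2 f3 f4 deg not_square_free_polyI by auto
  qed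
qed

text \<open>A solution of the five congruences. Adding multiples of \<open>modulus_poly\<close>
  cannot lower its degree 11: the leading coefficient 46656 of \<open>modulus_poly\<close> does not
  divide 2262816.\<close>

definition base_poly :: "int poly" where
  "base_poly = [:0, 0, 0, 0, -1393, -9697, -3777, 163386, 859032, 2423520, 3689712, 2262816:]"

definition modulus_poly :: "int poly" where
  "modulus_poly = [:0, 1:] ^ 2 * [:1, 2:] ^ 2 * [:1, -6:] ^ 2 * [:1, 6:] ^ 2 * [:1, 3:] ^ 2"

lemma base_poly_congruences:
  "[:0, 1:] ^ 2 dvd base_poly"
  "[:1, 2:] ^ 2 dvd base_poly - 1"
  "[:1, -6:] ^ 2 dvd base_poly + 1"
  "[:1, 6:] ^ 2 dvd base_poly - [:0, 1:]"
  "[:1, 3:] ^ 2 dvd base_poly + [:0, 1:]"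
proof -
  \<comment> \<open>Each explicit cofactor is the quotient by the square, so divisibility becomes an
    identity checked by expansion.\<close>
  have "base_poly = [:0, 1:] ^ 2 *
      [:0, 0, -1393, -9697, -3777, 163386, 859032, 2423520, 3689712, 2262816:]"
    by (simp add: base_poly_def power2_eq_square)
  then show "[:0, 1:] ^ 2 dvd base_poly" by (rule dvdI)
  have "base_poly - 1 = [:1, 2:] ^ 2 *
      [:-1, 4, -12, 32, -1473, -3933, 17847, 107730, 356724, 565704:]"
    by (simp add: base_poly_def power2_eq_square one_pCons)
  then show "[:1, 2:] ^ 2 dvd base_poly - 1" by (rule dvdI)
  have "base_poly + 1 = [:1, -6:] ^ 2 *
      [:1, 12, 108, 864, 5087, 20243, 56007, 106722, 123444, 62856:]"
    by (simp add: base_poly_def power2_eq_square one_pCons)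
  then show "[:1, -6:] ^ 2 dvd base_poly + 1" by (rule dvdI)
  have "base_poly - [:0, 1:] = [:1, 6:] ^ 2 *
      [:0, -1, 12, -108, -529, 539, 8799, 38394, 81540, 62856:]"
    by (simp add: base_poly_def power2_eq_square one_pCons)
  then show "[:1, 6:] ^ 2 dvd base_poly - [:0, 1:]" by (rule dvdI)
  have "base_poly + [:0, 1:] = [:1, 3:] ^ 2 *
      [:0, 1, -6, 27, -1501, -934, 15336, 79776, 242352, 251424:]"
    by (simp add: base_poly_def power2_eq_square one_pCons)
  then show "[:1, 3:] ^ 2 dvd base_poly + [:0, 1:]" by (rule dvdI)
qed

lemma modulus_poly_dvd:
  "[:0, 1:] ^ 2 dvd modulus_poly"
  "[:1, 2:] ^ 2 dvd modulus_poly"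
  "[:1, -6:] ^ 2 dvd modulus_poly"
  "[:1, 6:] ^ 2 dvd modulus_poly"
  "[:1, 3:] ^ 2 dvd modulus_poly"
  unfolding modulus_poly_def by (simp_all only: dvd_mult dvd_mult2 dvd_refl)

lemma degree_modulus_poly: "degree modulus_poly = 10"
  by (simp add: modulus_poly_def degree_mult_eq degree_power_eq)

lemma degree_base_poly: "degree base_poly = 11"
  by (simp add: base_poly_def)

lemma not_square_free_near_base_poly:
  assumes "poly_length (base_poly + q * modulus_poly - g) \<le> 1"
  shows "\<not> square_free_poly g"
proof (rule not_square_free_near[OF _ _ _ _ _ _ _ _ _ assms])
  note dvd = dvd_mult[OF modulus_poly_dvd(1), of q] dvd_mult[OF modulus_poly_dvd(2), of q]
    dvd_mult[OF modulus_poly_dvd(3), of q] dvd_mult[OF modulus_poly_dvd(4), of q]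
    dvd_mult[OF modulus_poly_dvd(5), of q]
  show "[:0, 1:] ^ 2 dvd base_poly + q * modulus_poly"
    using base_poly_congruences(1) dvd(1) by (rule dvd_add)
  show "[:1, 2:] ^ 2 dvd base_poly + q * modulus_poly - 1"
    using dvd_add[OF base_poly_congruences(2) dvd(2)] by (simp only: add_diff_eq diff_add_eq)
  show "[:1, -6:] ^ 2 dvd base_poly + q * modulus_poly + 1"
    using dvd_add[OF base_poly_congruences(3) dvd(3)] by (simp only: add_ac)
  show "[:1, 6:] ^ 2 dvd base_poly + q * modulus_poly - [:0, 1:]"
    using dvd_add[OF base_poly_congruences(4) dvd(4)] by (simp only: add_diff_eq diff_add_eq)
  show "[:1, 3:] ^ 2 dvd base_poly + q * modulus_poly + [:0, 1:]"
    using dvd_add[OF base_poly_congruences(5) dvd(5)] by (simp only: add_ac)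
qed simp_all

theorem theorem1p3:
  fixes d :: nat
  assumes "d \<ge> 15"
  shows "infinite {f :: int poly. degree f = d \<and>
           (\<forall>g :: int poly. poly_length (f - g) \<le> 1 \<longrightarrow> \<not> square_free_poly g)}"
    (is "infinite ?S")
proof -
  \<comment> \<open>Since \<open>modulus_poly\<close> has degree 10, the added term has degree
    \<open>d\<close> for nonzero \<open>c\<close>. As \<open>d\<close> exceeds 11, it determines the
    degree of the sum.\<close>
  define F where "F c = base_poly + monom c (d - 10) * modulus_poly" for c :: int
  have nz: "modulus_poly \<noteq> 0"
    using degree_modulus_poly by auto
  have "inj F"
    using nz by (auto simp: F_def intro!: injI)
  moreover have "degree (F c) = d" if "c \<noteq> 0" for c
  proof -
    have "degree (monom c (d - 10) * modulus_poly) = d"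
      using that nz assms by (simp add: degree_mult_eq degree_monom_eq degree_modulus_poly)
    then show ?thesis
      unfolding F_def using assms by (subst degree_add_eq_right) (auto simp: degree_base_poly)
  qed
  \<comment> \<open>The value 0 is left out because \<open>F 0\<close> is \<open>base_poly\<close>,
    of degree 11.\<close>
  then have "F ` (- {0}) \<subseteq> ?S"
    using not_square_free_near_base_poly unfolding F_def by auto
  moreover have "infinite (- {0 :: int})"
    by (simp add: infinite_UNIV_int)
  ultimately show ?thesis
    by (meson finite_imageD finite_subset inj_on_subset subset_UNIV)
qed

end
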